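(* Let $P\in\mathcal{P}\left(^2D\left(\frac{\pi}{4}\right)\right)$ and let $L\in\mathcal{L}^s\left(^2D\left(\frac{\pi}{4}\right)\right)$ be the polar of $P$. Then $$ \|L\|_{D\left(\frac{\pi}{4}\right)}\leq\left(2+\frac{\sqrt{2}}{2}\right)\|P\|_{D\left(\frac{\pi}{4}\right)}. $$ Moreover, equality is achieved for $P_1(x,y)=x^2+\left(5+4\sqrt{2}\right)y^2-\left(4+4\sqrt{2}\right)xy$. Hence, the polarization constant of $\mathcal{P}\left(^2D\left(\frac{\pi}{4}\right)\right)$ is $2+\frac{\sqrt{2}}{2}$.
   Context: $D\left(\frac{\pi}{4}\right):=\left\{e^{i\theta}:\theta\in\left[0,\frac{\pi}{4}\right]\right\}$, viewed as a subset of $\mathbb{R}^2$ (i.e. the points $(\cos\theta,\sin\theta)$ with $0\le\theta\le\pi/4$). $\mathcal{P}\left(^2D\left(\frac{\pi}{4}\right)\right)$ is the space of real $2$-homogeneous polynomials $P(x,y)=ax^2+by^2+cxy$ on $\mathbb{R}^2$ ($a,b,c\in\mathbb{R}$) endowed with the norm $\|P\|_{D\left(\frac{\pi}{4}\right)}=\sup\left\{|P(x,y)|:(x,y)\in D\left(\frac{\pi}{4}\right)\right\}$. $\mathcal{L}^s\left(^2D\left(\frac{\pi}{4}\right)\right)$ is the space of symmetric bilinear forms $L$ on $\mathbb{R}^2$ endowed with the norm $\|L\|_{D\left(\frac{\pi}{4}\right)}=\sup\left\{|L(v,w)|:v,w\in D\left(\frac{\pi}{4}\right)\right\}$. The polar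 of $P$ is the unique symmetric bilinear form $L$ on $\mathbb{R}^2$ with $L(v,v)=P(v)$ for all $v\in\mathbb{R}^2$. The polarization constant of $\mathcal{P}\left(^2D\left(\frac{\pi}{4}\right)\right)$ is the smallest constant $K>0$ such that $\|L\|_{D\left(\frac{\pi}{4}\right)}\leq K\|P\|_{D\left(\frac{\pi}{4}\right)}$ for all $P\in\mathcal{P}\left(^2D\left(\frac{\pi}{4}\right)\right)$ with polar $L$. *)

theory Defs
  imports "HOL-Analysis.Analysis"
begin

text \<open>The plane is \<^typ>\<open>real \<times> real\<close>.\<close>

definition sector :: "real \<Rightarrow> (real \<times> real) set" where
  "sector \<beta> = {(cos \<theta>, sin \<theta>) | \<theta>. \<theta> \<in> {0..\<beta>}}"

definition hom_polys2 :: "(real \<times> real \<Rightarrow> real) set" where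
  "hom_polys2 = {P. \<exists>a b c. \<forall>x y. P (x, y) = a * x\<^sup>2 + b * y\<^sup>2 + c * x * y}"

definition sym_bilinear_forms :: "(real \<times> real \<Rightarrow> real \<times> real \<Rightarrow> real) set" where
  "sym_bilinear_forms = {L. bilinear L \<and> (\<forall>v w. L v w = L w v)}"

text \<open>
  The suprema below are taken in the conditionally complete order of the reals, so they
  have their usual meaning for nonempty \<open>D\<close> and functions bounded on \<open>D\<close>; this covers
  all polynomials and bilinear forms when \<open>D\<close> is nonempty and compact, e.g. a sector with
  \<open>\<beta> \<ge> 0\<close>.
\<close>

definition poly_norm :: "(real \<times> real) set \<Rightarrow> (real \<times> real \<Rightarrow> real) \<Rightarrow> real" where
  "poly_norm D P = (SUP v\<in>D. \<bar>P v\<bar>)"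

definition form_norm ::
    "(real \<times> real) set \<Rightarrow> (real \<times> real \<Rightarrow> real \<times> real \<Rightarrow> real) \<Rightarrow> real" where
  "form_norm D L = (SUP (v, w)\<in>D \<times> D. \<bar>L v w\<bar>)"

definition polar :: "(real \<times> real \<Rightarrow> real) \<Rightarrow> real \<times> real \<Rightarrow> real \<times> real \<Rightarrow> real" where
  "polar P = (THE L. L \<in> sym_bilinear_forms \<and> (\<forall>v. L v v = P v))"

text \<open>The description in \<^const>\<open>polar\<close> is well defined on \<^const>\<open>hom_polys2\<close>.\<close>

lemma polar_ex1:
  assumes "P \<in> hom_polys2"
  shows "\<exists>!L. L \<in> sym_bilinear_forms \<and> (\<forall>v. L v v = P v)"
proof -
  obtain a b c where P: "\<And>x y. P (x, y) = a * x\<^sup>2 + b * y\<^sup>2 + c * x * y"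
    using assms unfolding hom_polys2_def by blast
  define L0 :: "real \<times> real \<Rightarrow> real \<times> real \<Rightarrow> real" where
    "L0 v w = a * fst v * fst w + b * snd v * snd w
        + c / 2 * (fst v * snd w + snd v * fst w)" for v w
  have L0: "L0 \<in> sym_bilinear_forms"
    unfolding sym_bilinear_forms_def bilinear_def L0_def
    by (auto intro!: linearI simp: algebra_simps add_divide_distrib)
  have diag: "L0 v v = P v" for v
    by (cases v) (simp add: P L0_def power2_eq_square algebra_simps)
  have polarize: "L v w = (P (v + w) - P v - P w) / 2"
    if L: "L \<in> sym_bilinear_forms" and LP: "\<And>v. L v v = P v" for L v w
  proof -
    have bl: "bilinear L" and sym: "L w v = L v w"
      using L unfolding sym_bilinear_forms_def by blast+
    have "P (v + w) = L (v + w) (v + w)" by (rule LP[symmetric])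
    also have "\<dots> = L v v + L w w + 2 * L v w"
      by (simp only: bilinear_ladd[OF bl] bilinear_radd[OF bl] sym)
    finally show ?thesis by (simp add: LP del: split_paired_All)
  qed
  show ?thesis
  proof (rule ex1I)
    show "L0 \<in> sym_bilinear_forms \<and> (\<forall>v. L0 v v = P v)"
      using L0 diag by blast
    show "L = L0" if "L \<in> sym_bilinear_forms \<and> (\<forall>v. L v v = P v)" for L
    proof (intro ext)
      fix v w
      have "L v w = (P (v + w) - P v - P w) / 2"
        by (rule polarize) (use that in blast)+
      also have "\<dots> = L0 v w"
        by (rule polarize[symmetric]) (fact L0 diag)+
      finally show "L v w = L0 v w" .
    qed
  qed
qed

lemma polar_eq_iff:
  assumes "P \<in> hom_polys2"
  shows "L = polar P \<longleftrightarrow> L \<in> sym_bilinear_forms \<and> (\<forall>v. L v v = P v)"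
proof
  show "L \<in> sym_bilinear_forms \<and> (\<forall>v. L v v = P v)" if "L = polar P"
    unfolding that polar_def by (rule theI'[OF polar_ex1[OF assms]])
  show "L = polar P" if "L \<in> sym_bilinear_forms \<and> (\<forall>v. L v v = P v)"
    unfolding polar_def using the1_equality[OF polar_ex1[OF assms]] that by blast
qed

definition polarization_bound :: "(real \<times> real) set \<Rightarrow> real \<Rightarrow> bool" where
  "polarization_bound D K \<longleftrightarrow>
     0 < K \<and> (\<forall>P\<in>hom_polys2. form_norm D (polar P) \<le> K * poly_norm D P)"

definition is_polarization_constant :: "(real \<times> real) set \<Rightarrow> real \<Rightarrow> bool" where
  "is_polarization_constant D K \<longleftrightarrow>
     polarization_bound D K \<and> (\<forall>K'. polarization_bound D K' \<longrightarrow> K \<le> K')"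

end

theory Submission
  imports Defs
begin

text \<open>
  Write \<open>e t = (cos t, sin t)\<close>.  In terms of angles, a symmetric bilinear form is
  \<open>L (e s) (e t) = A cos (s - t) + B cos (s + t) + C sin (s + t)\<close>, where \<open>2 A\<close> is its trace.
  Only the first summand notices that \<open>s\<close> and \<open>t\<close> differ once \<open>s + t\<close> is given, so
  comparison with the midpoint \<open>m = (s + t) / 2\<close> gives
  \<open>L (e s) (e t) = P (e m) - A (1 - cos (s - t))\<close>.
  The midpoint lies in the sector, so everything reduces to controlling \<open>A\<close> by values of \<open>P\<close>
  in the sector.  Three of them suffice, those at the two ends and in the middle:
  \<open>2 A (1 - cos \<beta>) = P (e 0) + P (e \<beta>) - 2 cos \<beta> P (e (\<beta> / 2))\<close>.
  Since \<open>1 - cos (s - t) \<le> 1 - cos \<beta>\<close> for angles in \<open>[0, \<beta>]\<close>, the triangle inequality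
  yields \<open>\<parallel>L\<parallel> \<le> (2 + \<bar>cos \<beta>\<bar>) \<parallel>P\<parallel>\<close> for every opening \<open>\<beta> \<le> \<pi>\<close>
  (\<open>abs_form_le_on_sector\<close>); the constant wanted is the case \<open>\<beta> = \<pi> / 4\<close>.

  For \<open>0 < \<beta> < \<pi> / 2\<close> and \<open>P \<noteq> 0\<close> all these estimates are sharp at once exactly
  when, up to the sign of \<open>P\<close> and the order of the arguments,
  \<open>P (e 0) = P (e \<beta>) = \<parallel>P\<parallel>\<close>, \<open>P (e (\<beta> / 2)) = - \<parallel>P\<parallel>\<close> and the arguments of \<open>L\<close> are
  \<open>e 0\<close> and \<open>e \<beta>\<close>.  These three values determine \<open>P\<close>; normalised to norm 1, it is
  \<open>P\<^sub>1\<close> when \<open>\<beta> = \<pi> / 4\<close>.  Its norm is at most 1, while its polar takes the value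
  \<open>- (2 + sqrt 2 / 2)\<close> at the two ends, so no smaller constant is possible.
\<close>

section \<open>Symmetric bilinear forms in angular coordinates\<close>

lemma sym_bilinear_form_angular:
  assumes "L \<in> sym_bilinear_forms"
  obtains A B C where "\<And>s t. L (cos s, sin s) (cos t, sin t)
      = A * cos (s - t) + B * cos (s + t) + C * sin (s + t)"
proof -
  have bl: "bilinear L" and sym: "\<And>v w. L v w = L w v"
    using assms unfolding sym_bilinear_forms_def by blast+
  define a b c where "a = L (1, 0) (1, 0)" "b = L (0, 1) (0, 1)" "c = L (1, 0) (0, 1)"
  have basis: "(x, y) = x *\<^sub>R (1, 0) + y *\<^sub>R (0, 1)" for x y :: real
    by simp
  have coords: "L (x, y) (x', y') = a * x * x' + b * y * y' + c * (x * y' + y * x')"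
    for x y x' y'
    unfolding basis[of x y] basis[of x' y'] bilinear_ladd[OF bl] bilinear_radd[OF bl]
      bilinear_lmul[OF bl] bilinear_rmul[OF bl]
    using sym[of "(0, 1)" "(1, 0)"] by (simp add: a_b_c_def algebra_simps)
  show ?thesis
    by (rule that[of "(a + b) / 2" "(a - b) / 2" c])
      (simp add: coords cos_add cos_diff sin_add field_simps)
qed

text \<open>
  The number \<open>A\<close> is half the trace of \<open>L\<close>.  The rest of \<open>L\<close> is \<open>f (s + t)\<close> with
  \<open>f x = B cos x + C sin x\<close>, so it does not change when \<open>s\<close> and \<open>t\<close> are both replaced by their
  midpoint; this is the first property.  The second one isolates \<open>A\<close> by means of
  \<open>f 0 + f (2 \<beta>) = 2 cos \<beta> f \<beta>\<close>.
\<close>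

lemma form_midpoint_defect:
  assumes "L \<in> sym_bilinear_forms"
  obtains A where
    "\<And>s t. L (cos s, sin s) (cos t, sin t)
       = L (cos ((s + t) / 2), sin ((s + t) / 2)) (cos ((s + t) / 2), sin ((s + t) / 2))
         - A * (1 - cos (s - t))"
    and "\<And>\<beta>. 2 * (A * (1 - cos \<beta>))
       = L (cos 0, sin 0) (cos 0, sin 0) + L (cos \<beta>, sin \<beta>) (cos \<beta>, sin \<beta>)
         - 2 * cos \<beta> * L (cos (\<beta> / 2), sin (\<beta> / 2)) (cos (\<beta> / 2), sin (\<beta> / 2))"
proof -
  obtain A B C where L: "\<And>s t. L (cos s, sin s) (cos t, sin t)
      = A * cos (s - t) + B * cos (s + t) + C * sin (s + t)"
    using sym_bilinear_form_angular[OF assms] by blast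
  show ?thesis
  proof (rule that[of A])
    fix s t \<beta> :: real
    show "L (cos s, sin s) (cos t, sin t)
        = L (cos ((s + t) / 2), sin ((s + t) / 2)) (cos ((s + t) / 2), sin ((s + t) / 2))
          - A * (1 - cos (s - t))"
      unfolding L by (simp add: algebra_simps)
    have "B * (1 + cos (\<beta> + \<beta>)) + C * sin (\<beta> + \<beta>) = 2 * cos \<beta> * (B * cos \<beta> + C * sin \<beta>)"
      using cos_double_cos[of \<beta>] sin_double[of \<beta>]
      by (simp add: algebra_simps power2_eq_square)
    then show "2 * (A * (1 - cos \<beta>))
        = L (cos 0, sin 0) (cos 0, sin 0) + L (cos \<beta>, sin \<beta>) (cos \<beta>, sin \<beta>)
          - 2 * cos \<beta> * L (cos (\<beta> / 2), sin (\<beta> / 2)) (cos (\<beta> / 2), sin (\<beta> / 2))"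
      unfolding L by (simp add: algebra_simps)
  qed
qed

section \<open>The polarization inequality on a sector\<close>

text \<open>
  The midpoint value contributes \<open>M\<close>, and the defect \<open>A (1 - cos (s - t))\<close> is largest for
  arguments \<open>\<beta>\<close> apart, where it is an average of three values of the polynomial with total weight
  \<open>1 + \<bar>cos \<beta>\<bar>\<close>.
\<close>

lemma abs_form_le_on_sector:
  assumes L: "L \<in> sym_bilinear_forms" and \<beta>: "0 \<le> \<beta>" "\<beta> \<le> pi"
    and M: "\<And>v. v \<in> sector \<beta> \<Longrightarrow> \<bar>L v v\<bar> \<le> M"
    and vw: "v \<in> sector \<beta>" "w \<in> sector \<beta>"
  shows "\<bar>L v w\<bar> \<le> (2 + \<bar>cos \<beta>\<bar>) * M"
proof -
  obtain s t where s: "v = (cos s, sin s)" "0 \<le> s" "s \<le> \<beta>"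
    and t: "w = (cos t, sin t)" "0 \<le> t" "t \<le> \<beta>"
    using vw unfolding sector_def by auto
  obtain A where mid: "\<And>s t. L (cos s, sin s) (cos t, sin t)
       = L (cos ((s + t) / 2), sin ((s + t) / 2)) (cos ((s + t) / 2), sin ((s + t) / 2))
         - A * (1 - cos (s - t))"
    and three: "\<And>\<beta>. 2 * (A * (1 - cos \<beta>))
       = L (cos 0, sin 0) (cos 0, sin 0) + L (cos \<beta>, sin \<beta>) (cos \<beta>, sin \<beta>)
         - 2 * cos \<beta> * L (cos (\<beta> / 2), sin (\<beta> / 2)) (cos (\<beta> / 2), sin (\<beta> / 2))"
    using form_midpoint_defect[OF L] by blast
  have P: "\<bar>L (cos r, sin r) (cos r, sin r)\<bar> \<le> M" if "0 \<le> r" "r \<le> \<beta>" for r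
    by (rule M) (use that in \<open>auto simp: sector_def\<close>)
  have "\<bar>2 * cos \<beta> * L (cos (\<beta> / 2), sin (\<beta> / 2)) (cos (\<beta> / 2), sin (\<beta> / 2))\<bar> \<le> 2 * \<bar>cos \<beta>\<bar> * M"
    using mult_left_mono[OF P[of "\<beta> / 2"], of "2 * \<bar>cos \<beta>\<bar>"] \<beta> by (simp add: abs_mult)
  then have "\<bar>2 * (A * (1 - cos \<beta>))\<bar> \<le> M + M + 2 * \<bar>cos \<beta>\<bar> * M"
    unfolding three using P[of 0] P[of \<beta>] \<beta> by linarith
  then have extreme: "\<bar>A\<bar> * (1 - cos \<beta>) \<le> (1 + \<bar>cos \<beta>\<bar>) * M"
    by (simp add: abs_mult algebra_simps)
  have "cos \<beta> \<le> cos \<bar>s - t\<bar>"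
    by (rule cos_monotone_0_pi_le) (use s t \<beta> in auto)
  then have "\<bar>A\<bar> * (1 - cos (s - t)) \<le> \<bar>A\<bar> * (1 - cos \<beta>)"
    by (intro mult_left_mono) auto
  with extreme have "\<bar>A * (1 - cos (s - t))\<bar> \<le> (1 + \<bar>cos \<beta>\<bar>) * M"
    by (simp add: abs_mult)
  moreover have
    "\<bar>L (cos ((s + t) / 2), sin ((s + t) / 2)) (cos ((s + t) / 2), sin ((s + t) / 2))\<bar> \<le> M"
    by (rule P) (use s t in auto)
  ultimately show ?thesis
    unfolding s t mid[of s t] by (simp add: algebra_simps)
qed

lemma abs_poly_le_poly_norm:
  assumes "P \<in> hom_polys2" "v \<in> sector \<beta>"
  shows "\<bar>P v\<bar> \<le> poly_norm (sector \<beta>) P"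
proof -
  obtain a b c where P: "\<And>x y. P (x, y) = a * x\<^sup>2 + b * y\<^sup>2 + c * x * y"
    using assms unfolding hom_polys2_def by blast
  have "\<bar>P (cos t, sin t)\<bar> \<le> \<bar>a\<bar> * 1 + \<bar>b\<bar> * 1 + \<bar>c\<bar> * (1 * 1)" for t
  proof -
    have "\<bar>a * (cos t)\<^sup>2\<bar> \<le> \<bar>a\<bar> * 1" "\<bar>b * (sin t)\<^sup>2\<bar> \<le> \<bar>b\<bar> * 1"
      "\<bar>c * (cos t * sin t)\<bar> \<le> \<bar>c\<bar> * (1 * 1)"
      unfolding abs_mult by (intro mult_mono; simp add: abs_square_le_1)+
    then show ?thesis unfolding P mult.assoc by linarith
  qed
  then have "bdd_above ((\<lambda>v. \<bar>P v\<bar>) ` sector \<beta>)"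
    unfolding sector_def by (intro bdd_aboveI2) auto
  then show ?thesis
    unfolding poly_norm_def using assms(2) by (rule cSUP_upper2) simp
qed

lemma polar_form:
  assumes "P \<in> hom_polys2"
  shows "polar P \<in> sym_bilinear_forms" "polar P v v = P v"
  using polar_eq_iff[OF assms, of "polar P"] by blast+

lemma abs_polar_le:
  assumes "P \<in> hom_polys2" "0 \<le> \<beta>" "\<beta> \<le> pi" "v \<in> sector \<beta>" "w \<in> sector \<beta>"
  shows "\<bar>polar P v w\<bar> \<le> (2 + \<bar>cos \<beta>\<bar>) * poly_norm (sector \<beta>) P"
  by (rule abs_form_le_on_sector)
    (use assms polar_form[OF assms(1)] abs_poly_le_poly_norm[OF assms(1)] in auto)

lemma form_norm_polar_le:
  assumes "P \<in> hom_polys2" "0 \<le> \<beta>" "\<beta> \<le> pi"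
  shows "form_norm (sector \<beta>) (polar P) \<le> (2 + \<bar>cos \<beta>\<bar>) * poly_norm (sector \<beta>) P"
proof -
  have "sector \<beta> \<noteq> {}"
    using assms by (auto simp: sector_def)
  then show ?thesis
    unfolding form_norm_def
    by (intro cSUP_least) (auto intro: abs_polar_le[OF assms])
qed

lemma abs_polar_le_form_norm:
  assumes "P \<in> hom_polys2" "0 \<le> \<beta>" "\<beta> \<le> pi" "v \<in> sector \<beta>" "w \<in> sector \<beta>"
  shows "\<bar>polar P v w\<bar> \<le> form_norm (sector \<beta>) (polar P)"
proof -
  have "bdd_above ((\<lambda>(v, w). \<bar>polar P v w\<bar>) ` (sector \<beta> \<times> sector \<beta>))"
    by (rule bdd_aboveI2[where M = "(2 + \<bar>cos \<beta>\<bar>) * poly_norm (sector \<beta>) P"])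
      (auto intro: abs_polar_le[OF assms(1-3)])
  from cSUP_upper[OF _ this, of "(v, w)"] show ?thesis
    unfolding form_norm_def using assms by simp
qed

lemma polar_eq_polarization:
  assumes "P \<in> hom_polys2"
  shows "polar P v w = (P (v + w) - P v - P w) / 2"
proof -
  have bl: "bilinear (polar P)" and sym: "polar P w v = polar P v w"
    using polar_form(1)[OF assms] unfolding sym_bilinear_forms_def by blast+
  have "polar P (v + w) (v + w) = polar P v v + polar P w w + 2 * polar P v w"
    by (simp only: bilinear_ladd[OF bl] bilinear_radd[OF bl] sym)
  then have "P (v + w) = P v + P w + 2 * polar P v w"
    by (simp only: polar_form(2)[OF assms])
  then show ?thesis by simp
qed

section \<open>The extremal polynomial for the opening \<open>\<pi> / 4\<close>\<close>

definition extremal_poly :: "real \<times> real \<Rightarrow> real" where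
  "extremal_poly = (\<lambda>(x, y). x\<^sup>2 + (5 + 4 * sqrt 2) * y\<^sup>2 - (4 + 4 * sqrt 2) * x * y)"

lemma extremal_poly_hom: "extremal_poly \<in> hom_polys2"
proof -
  have "\<forall>x y. extremal_poly (x, y)
      = 1 * x\<^sup>2 + (5 + 4 * sqrt 2) * y\<^sup>2 + (- (4 + 4 * sqrt 2)) * x * y"
    by (simp add: extremal_poly_def algebra_simps)
  then show ?thesis
    unfolding hom_polys2_def by blast
qed

text \<open>
  On the circle the polynomial is an affine function of \<open>cos (2 t) + sin (2 t)\<close>.  For
  \<open>t\<close> in \<open>[0, \<pi> / 4]\<close> this sum ranges over \<open>[1, sqrt 2]\<close>, and the affine function maps the
  end points of that interval to \<open>1\<close> and \<open>-1\<close>.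
\<close>

lemma poly_norm_extremal_le: "poly_norm (sector (pi / 4)) extremal_poly \<le> 1"
  unfolding poly_norm_def
proof (rule cSUP_least)
  show "sector (pi / 4) \<noteq> {}" by (auto simp: sector_def)
  fix v assume "v \<in> sector (pi / 4)"
  then obtain t where t: "v = (cos t, sin t)" "0 \<le> t" "t \<le> pi / 4"
    unfolding sector_def by auto
  define u where "u = cos (2 * t) + sin (2 * t)"
  have sq: "(sin t)\<^sup>2 = 1 - (cos t)\<^sup>2"
    using sin_cos_squared_add[of t] by linarith
  have val: "extremal_poly v = 3 + 2 * sqrt 2 - (2 + 2 * sqrt 2) * u"
    unfolding t extremal_poly_def u_def cos_double_cos sin_double
    by (simp add: sq algebra_simps)
  have pos: "0 \<le> cos (2 * t)" "0 \<le> sin (2 * t)"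
    using t by (auto intro!: cos_ge_zero sin_ge_zero)
  have u2: "u\<^sup>2 = 1 + 2 * (cos (2 * t) * sin (2 * t))"
    using sin_cos_squared_add[of "2 * t"] by (simp add: u_def power2_eq_square algebra_simps)
  have "2 * (cos (2 * t) * sin (2 * t)) = sin (2 * (2 * t))"
    by (simp only: sin_double[of "2 * t"] mult.assoc mult.commute[of "cos (2 * t)"])
  then have "u\<^sup>2 \<le> 2"
    using u2 sin_le_one[of "2 * (2 * t)"] by linarith
  then have "u \<le> sqrt 2" by (rule real_le_rsqrt)
  have "1\<^sup>2 \<le> u\<^sup>2" using u2 pos by simp
  then have "1 \<le> u" by (rule power2_le_imp_le) (use pos in \<open>simp add: u_def\<close>)
  have "(2 + 2 * sqrt 2) * 1 \<le> (2 + 2 * sqrt 2) * u"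
    using \<open>1 \<le> u\<close> by (intro mult_left_mono) auto
  moreover have "(2 + 2 * sqrt 2) * u \<le> (2 + 2 * sqrt 2) * sqrt 2"
    using \<open>u \<le> sqrt 2\<close> by (intro mult_left_mono) auto
  ultimately show "\<bar>extremal_poly v\<bar> \<le> 1"
    unfolding val by (simp add: algebra_simps)
qed

lemma form_norm_extremal_ge:
  "2 + sqrt 2 / 2 \<le> form_norm (sector (pi / 4)) (polar extremal_poly)"
proof -
  have "(1, 0) = (cos 0, sin 0 :: real)"
    and "(sqrt 2 / 2, sqrt 2 / 2) = (cos (pi / 4), sin (pi / 4))"
    by (simp_all add: cos_45 sin_45)
  then have ends: "(1, 0) \<in> sector (pi / 4)" "(sqrt 2 / 2, sqrt 2 / 2) \<in> sector (pi / 4)"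
    unfolding sector_def by fastforce+
  have "polar extremal_poly (1, 0) (sqrt 2 / 2, sqrt 2 / 2) = - (2 + sqrt 2 / 2)"
    unfolding polar_eq_polarization[OF extremal_poly_hom]
    by (simp add: extremal_poly_def power2_eq_square field_simps)
  then show ?thesis
    using abs_polar_le_form_norm[OF extremal_poly_hom _ _ ends] by simp
qed

theorem corollary3p3:
  defines "D \<equiv> sector (pi / 4)"
  defines "P\<^sub>1 \<equiv> (\<lambda>(x, y). x\<^sup>2 + (5 + 4 * sqrt 2) * y\<^sup>2 - (4 + 4 * sqrt 2) * x * y)"
  shows "(\<forall>P\<in>hom_polys2. \<forall>L\<in>sym_bilinear_forms. L = polar P \<longrightarrow>
            form_norm D L \<le> (2 + sqrt 2 / 2) * poly_norm D P) \<and>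
         (P\<^sub>1 \<in> hom_polys2 \<and>
            form_norm D (polar P\<^sub>1) = (2 + sqrt 2 / 2) * poly_norm D P\<^sub>1) \<and>
         is_polarization_constant D (2 + sqrt 2 / 2)"
proof -
  let ?K = "2 + sqrt 2 / 2 :: real"
  have P1: "P\<^sub>1 = extremal_poly"
    by (simp add: P\<^sub>1_def extremal_poly_def)
  have upper: "form_norm D (polar P) \<le> ?K * poly_norm D P" if "P \<in> hom_polys2" for P
    using form_norm_polar_le[OF that, of "pi / 4"] by (simp add: D_def cos_45)
  have scale: "C * poly_norm D P\<^sub>1 \<le> C" if "0 < C" for C
    using mult_left_mono[OF poly_norm_extremal_le, of C] that by (simp add: P1 D_def)
  have lower: "?K \<le> form_norm D (polar P\<^sub>1)"
    using form_norm_extremal_ge by (simp add: P1 D_def)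
  have Kpos: "0 < ?K" by (simp add: add_pos_pos)
  have "P\<^sub>1 \<in> hom_polys2"
    by (simp add: P1 extremal_poly_hom)
  moreover have "form_norm D (polar P\<^sub>1) = ?K * poly_norm D P\<^sub>1"
    using upper[OF \<open>P\<^sub>1 \<in> hom_polys2\<close>] scale[OF Kpos] lower by linarith
  moreover have "?K \<le> K'" if "polarization_bound D K'" for K'
  proof -
    have "form_norm D (polar P\<^sub>1) \<le> K' * poly_norm D P\<^sub>1" "0 < K'"
      using that \<open>P\<^sub>1 \<in> hom_polys2\<close> unfolding polarization_bound_def by auto
    then show ?thesis
      using lower scale[of K'] by linarith
  qed
  ultimately show ?thesis
    using upper Kpos unfolding is_polarization_constant_def polarization_bound_def by blast
qed

end
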